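(* Consider the nonlinear system $\mathbf{x}_{k+1}=\boldsymbol{f}(\mathbf{x}_k,\mathbf{u}_k)$, $\mathbf{y}_k=\boldsymbol{h}(\mathbf{x}_k)$ and the setting described in the context, and suppose Assumptions 1-6 listed there are satisfied. Let $\{\mathbf{u}_k\}_{k=0}^{N-1}$, $\{\tilde y_{i,k}\}_{k=0}^{N+d_i-1}$, $i=1,\dots,m$, be input and noisy output data collected from the system. Let $\{\bar y_{i,k}\}_{k=0}^{L+d_i-1}$, $i=1,\dots,m$, be desired reference trajectories (outputs of the system), with $\bar\Xi_0=[\bar y_{1,[0,d_1-1]}^\top\ \cdots\ \bar y_{m,[0,d_m-1]}^\top]^\top$ specifying the initial condition. Let $\lambda>0$, and let the following optimization problem be feasible for the given $\bar\Xi_0$: $$\alpha^*\in\arg\min_{\alpha\in\mathbb{R}^{N-L+1}} J(\alpha):=\|\mathcal{H}(\alpha)\|_2^2+\lambda\max\{\varepsilon^*,w^*\}\|\alpha\|_2^2\quad\text{s.t.}\quad \bar\Xi_0=H_1(\tilde\Xi_{[0,N-L]})\alpha,$$ where $$\mathcal{H}(\alpha):=\begin{bmatrix}H_L(\hat\Psi(\mathbf{u},\tilde\Xi))\\ H_{L+1}(\tilde\Xi)\end{bmatrix}\alpha-\begin{bmatrix}\hat\Psi(H_L(\mathbf{u})\alpha,\bar\Xi)\\ \bar\Xi\end{bmatrix}.$$ Let $\hat{\mathbf{u}}:=H_L(\mathbf{u})\alpha^*$ be the estimated input and let $\hat y_{i,[0,L+d_i-1]}$, $i=1,\dots,m$,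 be the outputs resulting when $\hat{\mathbf{u}}$ is applied to the nonlinear system from the initial condition specified by $\bar\Xi_0$. Then the error $e_i:=\bar y_i-\hat y_i$ satisfies $e_{i,[0,d_i-1]}=\mathbf{0}$ and $$|e_{i,k+d_i}|\le\mathcal{P}^k(K_\Xi)\Big(\varepsilon^*(1+\|\alpha^*\|_1)+(\|\mathcal{G}\|_\infty+1)\sqrt{b}+w^*(1+K_w)\|\alpha^*\|_1\Big)$$ for all $k\in\{0,\dots,L-1\}$ and all $i\in\{1,\dots,m\}$, where $b=J(\alpha^* )-\lambda\max\{\varepsilon^*,w^*\}\|\alpha^*\|_2^2$ and $\mathcal{P}^k(K_\Xi)=(K_\Xi)^k+(K_\Xi)^{k-1}+\dots+K_\Xi+1$.
   Context: Notation. For a sequence $\{\mathbf{z}_k\}_{k=0}^{N-1}$ with $\mathbf{z}_k\in\mathbb{R}^\eta$, $\mathbf{z}=[\mathbf{z}_0^\top\ \cdots\ \mathbf{z}_{N-1}^\top]^\top$ is its stacked vector, $\mathbf{z}_{[a,b]}=[\mathbf{z}_a^\top\ \cdots\ \mathbf{z}_b^\top]^\top$ a window, and the depth-$L$ Hankel matrix $H_L(\mathbf{z})\in\mathbb{R}^{\eta L\times(N-L+1)}$ has as its $j$-th column ($j=0,\dots,N-L$) the vector $\mathbf{z}_{[j,j+L-1]}$. $\|\cdot\|_p$ is the $p$-norm of vectors and $\|M\|_\infty$ the induced $\infty$-norm of a matrix. System. $\mathbf{x}_{k+1}=\boldsymbol{f}(\mathbf{x}_k,\mathbf{u}_k)$,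 $\mathbf{y}_k=\boldsymbol{h}(\mathbf{x}_k)$ with $\mathbf{x}_k\in\mathbb{R}^n$, $\mathbf{u}_k,\mathbf{y}_k\in\mathbb{R}^m$, where $\boldsymbol{f}:\mathbb{R}^n\times\mathbb{R}^m\to\mathbb{R}^n$ and $\boldsymbol{h}=(h_1,\dots,h_m):\mathbb{R}^n\to\mathbb{R}^m$ are analytic, $\boldsymbol{f}(\mathbf{0},\mathbf{0})=\mathbf{0}$, $\boldsymbol{h}(\mathbf{0})=\mathbf{0}$. Let $\boldsymbol{f}_O^j$ be the $j$-th iterated composition of $\boldsymbol{f}_O=\boldsymbol{f}(\cdot,\mathbf{0})$. Each output $y_i$ has a globally well-defined relative degree $d_i\ge 1$: $d_i$ is the first delay at which at least one input at time $k$ affects output $i$, so that $y_{i,k},\dots,y_{i,k+d_i-1}$ do not depend on $\mathbf{u}_k,\mathbf{u}_{k+1},\dots$ (they are functions of $\mathbf{x}_k$), and $y_{i,k+d_i}=h_i(\boldsymbol{f}_O^{d_i-1}(\boldsymbol{f}(\mathbf{x}_k,\mathbf{u}_k)))$. For inputs $\{\mathbf{u}_k\}_{k=0}^{N-1}$, the outputs $y_{i,k}$ with $0\le k\le N+d_i-1$ are determined by $\mathbf{x}_0$ and these inputs. Assumption 1: for any $\mathbf{x}_k\in\mathbb{R}^n$ there is $\tilde{\mathbf{u}}_k\in\mathbb{R}^m$ with $h_i(\boldsymbol{f}_O^{d_i-1}(\boldsymbol{f}(\mathbf{x}_k,\tilde{\mathbf{u}}_k)))=0$ for all $i=1,\dots,m$.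 Assumption 2: for any $\mathbf{x}_k\in\mathbb{R}^n$, the decoupling matrix with entries $\partial h_i(\boldsymbol{f}_O^{d_i-1}(\boldsymbol{f}(\mathbf{x}_k,\mathbf{u}_k)))/\partial u_{j,k}$, evaluated at $\mathbf{u}_k=\tilde{\mathbf{u}}_k$, has rank $m$. Assumption 3: $\sum_{i=1}^m d_i=n$. Under Assumptions 1-3 it is a known result (Monaco and Normand-Cyrot), which may be used, that there is an invertible coordinate transformation $\Xi_k=T(\mathbf{x}_k)$ on $\mathbb{R}^n$, where $\Xi_k=[y_{1,[k,k+d_1-1]}^\top\ \cdots\ y_{m,[k,k+d_m-1]}^\top]^\top$; $T^{-1}$ is continuously differentiable. The initial condition specified by $\bar\Xi_0$ is $\bar{\mathbf{x}}_0=T^{-1}(\bar\Xi_0)$. Define $\Phi(\mathbf{u},\Xi)=(\phi_1,\dots,\phi_m)(\mathbf{u},\Xi)$ by $\phi_i(\mathbf{u},\Xi)=h_i(\boldsymbol{f}_O^{d_i-1}(\boldsymbol{f}(T^{-1}(\Xi),\mathbf{u})))$, so that $y_{i,k+d_i}=\phi_i(\mathbf{u}_k,\Xi_k)$ along trajectories. $\Phi$ is locally Lipschitz. Basis functions. $\Psi:\mathbb{R}^m\times\mathbb{R}^n\to\mathbb{R}^r$ is a vector of $r$ locally Lipschitz, linearly independent functions $\psi_1,\dots,\psi_r$, and $\Phi(\mathbf{u},\Xi)=\mathcal{G}\Psi(\mathbf{u},\Xi)+\epsilon(\mathbf{u},\Xi)$, where $\mathcal{G}\in\mathbb{R}^{m\times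 r}$ is a minimizer over $G$ of $\langle\Phi-G\Psi,\Phi-G\Psi\rangle$ ($L^2$ inner product over a compact set $\Omega\subset\mathbb{R}^m\times\mathbb{R}^n$), and $\epsilon$ is the approximation error. Assumption 4: $\mathcal{G}$ has full row rank. Assumption 5: $\|\epsilon(\mathbf{u},\Xi)\|_\infty\le\varepsilon^*$ for all $(\mathbf{u},\Xi)\in\Omega$, where $\varepsilon^*>0$ and $\Omega$ is compact. Assumption 6: $\psi_j(\mathbf{u}_k,\Xi_k)=u_{j,k}$ for all $j=1,\dots,m$. Noise. Measured outputs are $\tilde{\mathbf{y}}_k=\mathbf{y}_k+\mathbf{w}_k$ with $\|\mathbf{w}_k\|_\infty\le w^*$ for all $k$. Put $\omega_k=[w_{1,[k,k+d_1-1]}^\top\ \cdots\ w_{m,[k,k+d_m-1]}^\top]^\top$ and $\tilde\Xi_k=\Xi_k+\omega_k=[\tilde y_{1,[k,k+d_1-1]}^\top\ \cdots\ \tilde y_{m,[k,k+d_m-1]}^\top]^\top$, $k=0,\dots,N$, with stacked vector $\tilde\Xi$. Let $\delta(\omega_k)=\mathcal{G}\Psi(\mathbf{u}_k,\Xi_k)+\epsilon(\mathbf{u}_k,\Xi_k)-\mathcal{G}\Psi(\mathbf{u}_k,\tilde\Xi_k)-\epsilon(\mathbf{u}_k,\tilde\Xi_k)$. Reference state. $\bar\Xi_k=[\bar y_{1,[k,k+d_1-1]}^\top\ \cdots\ \bar y_{m,[k,k+d_m-1]}^\top]^\top$, $k=0,\dots,L$, with stacked vector $\bar\Xi$; similarly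 $\hat\Xi_k=[\hat y_{1,[k,k+d_1-1]}^\top\ \cdots\ \hat y_{m,[k,k+d_m-1]}^\top]^\top$. Standing assumption. The collected data (both $(\mathbf{u}_k,\Xi_k)$ and $(\mathbf{u}_k,\tilde\Xi_k)$) and the matched trajectories (both the reference state and the achieved state paired with the estimated input, $(\hat{\mathbf{u}}_k,\bar\Xi_k)$ and $(\hat{\mathbf{u}}_k,\hat\Xi_k)$) lie in $\Omega$. Constants. $K_\Xi$ is the Lipschitz constant of $\Phi$ with respect to $\Xi$ on $\Omega$ (in the $\infty$-norm). $K_w>0$ is a constant with $\|\delta(\omega_k)\|_\infty\le K_w w^*$ for all $k\ge 0$ (it exists by local Lipschitz continuity). Stacked vectors. $\hat\Psi(\mathbf{u},\tilde\Xi)$ is the stacked vector of $\{\Psi(\mathbf{u}_k,\tilde\Xi_k)\}_{k=0}^{N-1}$. For $\alpha\in\mathbb{R}^{N-L+1}$, $\hat\Psi(H_L(\mathbf{u})\alpha,\bar\Xi)$ is the stacked vector of $\{\Psi(H_1(\mathbf{u}_{[k,k+N-L]})\alpha,\bar\Xi_k)\}_{k=0}^{L-1}$. *)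

theory Defs
  imports "HOL-Analysis.Analysis"
begin

subsection \<open>Regularity of maps between Euclidean spaces\<close>

text \<open>Around every point the map is the sum of a multivariate power series. A multi-index is a
  function on the standard basis, extended by 0 to the whole type so that each multi-index is
  counted once.\<close>

definition multi_indices :: "('a::euclidean_space \<Rightarrow> nat) set" where
  "multi_indices = {\<nu>. \<forall>b. b \<notin> Basis \<longrightarrow> \<nu> b = 0}"

definition real_analytic :: "('a::euclidean_space \<Rightarrow> 'b::euclidean_space) \<Rightarrow> bool" where
  "real_analytic g \<longleftrightarrow>
     (\<forall>x. \<exists>c. \<exists>\<rho>>0. \<forall>y\<in>ball x \<rho>.
        ((\<lambda>\<nu>. (\<Prod>b\<in>Basis. ((y - x) \<bullet> b) ^ \<nu> b) *\<^sub>R c \<nu>) has_sum g y) multi_indices)"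

definition continuously_differentiable ::
    "('a::real_normed_vector \<Rightarrow> 'b::real_normed_vector) \<Rightarrow> bool" where
  "continuously_differentiable g \<longleftrightarrow>
     (\<exists>D :: 'a \<Rightarrow> 'a \<Rightarrow>\<^sub>L 'b.
        (\<forall>x. (g has_derivative blinfun_apply (D x)) (at x)) \<and> continuous_on UNIV D)"

definition locally_lipschitz :: "('a::metric_space \<Rightarrow> 'b::metric_space) \<Rightarrow> bool" where
  "locally_lipschitz g \<longleftrightarrow> (\<forall>z. \<exists>\<rho>>0. \<exists>C. C-lipschitz_on (ball z \<rho>) g)"

definition lin_indep_funs :: "('a \<Rightarrow> real ^ 'r) \<Rightarrow> bool" where
  "lin_indep_funs \<Psi> \<longleftrightarrow>
     (\<forall>c :: 'r \<Rightarrow> real. (\<forall>z. (\<Sum>l\<in>UNIV. c l * \<Psi> z $ l) = 0) \<longrightarrow> (\<forall>l. c l = 0))"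

definition L2_inner ::
    "'a::euclidean_space set \<Rightarrow> ('a \<Rightarrow> real ^ 'm) \<Rightarrow> ('a \<Rightarrow> real ^ 'm) \<Rightarrow> real" where
  "L2_inner \<Omega> g g' = (LINT z:\<Omega>|lborel. g z \<bullet> g' z)"

text \<open>The operator norm induced by the max-norm, in the style of \<^const>\<open>onorm\<close>
  (the quotient at 0 is 0).\<close>

definition mat_infnorm :: "real ^ 'c ^ 'm \<Rightarrow> real" where
  "mat_infnorm A = (SUP x. infnorm (A *v x) / infnorm x)"


subsection \<open>The system\<close>

primrec state ::
    "((real ^ 'n) \<times> (real ^ 'm) \<Rightarrow> real ^ 'n) \<Rightarrow> real ^ 'n \<Rightarrow> (nat \<Rightarrow> real ^ 'm) \<Rightarrow> nat \<Rightarrow> real ^ 'n" where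
  "state f x0 u 0 = x0"
| "state f x0 u (Suc k) = f (state f x0 u k, u k)"

definition sys_output ::
    "((real ^ 'n) \<times> (real ^ 'm) \<Rightarrow> real ^ 'n) \<Rightarrow> (real ^ 'n \<Rightarrow> real ^ 'm) \<Rightarrow> real ^ 'n \<Rightarrow> (nat \<Rightarrow> real ^ 'm) \<Rightarrow> nat \<Rightarrow> real ^ 'm"
  where "sys_output f h x0 u k = h (state f x0 u k)"

definition drift :: "((real ^ 'n) \<times> (real ^ 'm) \<Rightarrow> real ^ 'n) \<Rightarrow> real ^ 'n \<Rightarrow> real ^ 'n" where
  "drift f x = f (x, 0)"

text \<open>By the second clause, the output \<open>i\<close> at delay \<open>d\<close> is the expression in the third clause, with \<open>v\<close>
  the first input; only this input enters.\<close>

definition relative_degree ::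
    "((real ^ 'n) \<times> (real ^ 'm) \<Rightarrow> real ^ 'n) \<Rightarrow> (real ^ 'n \<Rightarrow> real ^ 'm) \<Rightarrow> 'm \<Rightarrow> nat \<Rightarrow> bool" where
  "relative_degree f h i d \<longleftrightarrow>
     1 \<le> d \<and>
     (\<forall>x u u'. \<forall>j<d. sys_output f h x u j $ i = sys_output f h x u' j $ i) \<and>
     (\<forall>x. \<exists>v v'. h ((drift f ^^ (d - 1)) (f (x, v))) $ i
              \<noteq> h ((drift f ^^ (d - 1)) (f (x, v'))) $ i)"

definition delayed_output ::
    "((real ^ 'n) \<times> (real ^ 'm) \<Rightarrow> real ^ 'n) \<Rightarrow> (real ^ 'n \<Rightarrow> real ^ 'm) \<Rightarrow> ('m \<Rightarrow> nat) \<Rightarrow> real ^ 'n \<Rightarrow> real ^ 'm \<Rightarrow> real ^ 'm"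
  where "delayed_output f h d x u = (\<chi> i. h ((drift f ^^ (d i - 1)) (f (x, u))) $ i)"

definition decoupling_matrix ::
    "((real ^ 'n) \<times> (real ^ 'm) \<Rightarrow> real ^ 'n) \<Rightarrow> (real ^ 'n \<Rightarrow> real ^ 'm) \<Rightarrow> ('m \<Rightarrow> nat) \<Rightarrow> real ^ 'n \<Rightarrow> real ^ 'm \<Rightarrow> real ^ 'm ^ 'm"
  where "decoupling_matrix f h d x u = jacobian (delayed_output f h d x) (at u)"

text \<open>The \<open>n\<close> coordinates of \<open>\<Xi>\<^sub>k\<close> are the \<open>y\<^sub>i\<^sub>,\<^sub>k\<^sub>+\<^sub>j\<close> with \<open>j < d i\<close>. An enumeration of these pairs
  \<open>(i, j)\<close> by the index type \<open>'n\<close> says which coordinate of \<open>\<Xi>\<^sub>k\<close> holds which of them.\<close>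

definition stacking :: "('m \<Rightarrow> nat) \<Rightarrow> ('n \<Rightarrow> 'm \<times> nat) \<Rightarrow> bool" where
  "stacking d \<sigma> \<longleftrightarrow> bij_betw \<sigma> UNIV (SIGMA i:UNIV. {..<d i})"

definition ext_state :: "('n \<Rightarrow> 'm \<times> nat) \<Rightarrow> (nat \<Rightarrow> real ^ 'm) \<Rightarrow> nat \<Rightarrow> real ^ 'n" where
  "ext_state \<sigma> y k = (\<chi> p. y (k + snd (\<sigma> p)) $ fst (\<sigma> p))"

text \<open>\<open>T\<close>: the output \<open>y\<^sub>i\<^sub>,\<^sub>k\<^sub>+\<^sub>j\<close> with \<open>j < d i\<close> does not depend on the inputs from time \<open>k\<close> on, so as
  a function of \<open>x\<^sub>k\<close> it is obtained by applying zero inputs.\<close>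

definition coord_map ::
    "((real ^ 'n) \<times> (real ^ 'm) \<Rightarrow> real ^ 'n) \<Rightarrow> (real ^ 'n \<Rightarrow> real ^ 'm) \<Rightarrow> ('n \<Rightarrow> 'm \<times> nat) \<Rightarrow> real ^ 'n \<Rightarrow> real ^ 'n" where
  "coord_map f h \<sigma> x = (\<chi> p. h ((drift f ^^ snd (\<sigma> p)) x) $ fst (\<sigma> p))"

definition Phi ::
    "((real ^ 'n) \<times> (real ^ 'm) \<Rightarrow> real ^ 'n) \<Rightarrow> (real ^ 'n \<Rightarrow> real ^ 'm) \<Rightarrow> ('m \<Rightarrow> nat) \<Rightarrow> ('n \<Rightarrow> 'm \<times> nat) \<Rightarrow>
     (real ^ 'm) \<times> (real ^ 'n) \<Rightarrow> real ^ 'm" where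
  "Phi f h d \<sigma> = (\<lambda>(u, \<Xi>). delayed_output f h d (inv (coord_map f h \<sigma>) \<Xi>) u)"


subsection \<open>Hankel matrices and the optimization problem\<close>

text \<open>A stacked vector is the sequence of its blocks. The sequences are total functions on the
  naturals; their lengths are passed explicitly where they matter. An element of
  \<open>\<real>\<^sup>N\<^sup>-\<^sup>L\<^sup>+\<^sup>1\<close> is likewise a function of which only the values at \<open>0, \<dots>, N - L\<close> enter.
  The row index \<open>(k, c)\<close> of a Hankel matrix means component \<open>c\<close> of block \<open>k\<close>.\<close>

definition window :: "(nat \<Rightarrow> 'a) \<Rightarrow> nat \<Rightarrow> nat \<Rightarrow> 'a" where
  "window z a = (\<lambda>k. z (a + k))"

definition hankel :: "(nat \<Rightarrow> real ^ 'c) \<Rightarrow> nat \<times> 'c \<Rightarrow> nat \<Rightarrow> real" where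
  "hankel z = (\<lambda>(k, c) j. window z j k $ c)"

text \<open>Block \<open>k < L\<close> of \<open>H\<^sub>L(z) \<alpha>\<close> for a sequence \<open>z\<close> of length \<open>M\<close>; the matrix has \<open>M - L + 1\<close> columns.\<close>

definition hankel_mult ::
    "nat \<Rightarrow> nat \<Rightarrow> (nat \<Rightarrow> real ^ 'c) \<Rightarrow> (nat \<Rightarrow> real) \<Rightarrow> nat \<Rightarrow> real ^ 'c" where
  "hankel_mult M L z \<alpha> k = (\<chi> c. \<Sum>j<M - L + 1. hankel z (k, c) j * \<alpha> j)"

definition norm1 :: "nat \<Rightarrow> (nat \<Rightarrow> real) \<Rightarrow> real" where
  "norm1 q \<alpha> = (\<Sum>j<q. \<bar>\<alpha> j\<bar>)"

definition sq_norm2 :: "nat \<Rightarrow> (nat \<Rightarrow> real) \<Rightarrow> real" where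
  "sq_norm2 q \<alpha> = (\<Sum>j<q. (\<alpha> j)\<^sup>2)"

definition sq_norm2_stacked :: "nat \<Rightarrow> (nat \<Rightarrow> real ^ 'c) \<Rightarrow> real" where
  "sq_norm2_stacked q z = (\<Sum>k<q. \<Sum>c\<in>UNIV. (z k $ c)\<^sup>2)"

text \<open>The upper part (\<open>L\<close> blocks of size \<open>r\<close>) and the lower part (\<open>L + 1\<close> blocks of size \<open>n\<close>) of
  \<open>\<H>(\<alpha>)\<close>. Here \<open>\<Xi>t\<close> is the noisy extended state, of length \<open>N + 1\<close>, and \<open>\<Xi>r\<close> the reference one.\<close>

definition residual_basis ::
    "nat \<Rightarrow> nat \<Rightarrow> ((real ^ 'm) \<times> (real ^ 'n) \<Rightarrow> real ^ 'r) \<Rightarrow> (nat \<Rightarrow> real ^ 'm) \<Rightarrow>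
     (nat \<Rightarrow> real ^ 'n) \<Rightarrow> (nat \<Rightarrow> real ^ 'n) \<Rightarrow> (nat \<Rightarrow> real) \<Rightarrow> nat \<Rightarrow> real ^ 'r" where
  "residual_basis N L \<Psi> u \<Xi>t \<Xi>r \<alpha> k =
     hankel_mult N L (\<lambda>l. \<Psi> (u l, \<Xi>t l)) \<alpha> k
     - \<Psi> (hankel_mult (N - L + 1) 1 (window u k) \<alpha> 0, \<Xi>r k)"

definition residual_state ::
    "nat \<Rightarrow> nat \<Rightarrow> (nat \<Rightarrow> real ^ 'n) \<Rightarrow> (nat \<Rightarrow> real ^ 'n) \<Rightarrow> (nat \<Rightarrow> real) \<Rightarrow> nat \<Rightarrow> real ^ 'n" where
  "residual_state N L \<Xi>t \<Xi>r \<alpha> k = hankel_mult (N + 1) (L + 1) \<Xi>t \<alpha> k - \<Xi>r k"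

definition cost ::
    "nat \<Rightarrow> nat \<Rightarrow> ((real ^ 'm) \<times> (real ^ 'n) \<Rightarrow> real ^ 'r) \<Rightarrow> (nat \<Rightarrow> real ^ 'm) \<Rightarrow>
     (nat \<Rightarrow> real ^ 'n) \<Rightarrow> (nat \<Rightarrow> real ^ 'n) \<Rightarrow> real \<Rightarrow> (nat \<Rightarrow> real) \<Rightarrow> real" where
  "cost N L \<Psi> u \<Xi>t \<Xi>r \<mu> \<alpha> =
     sq_norm2_stacked L (residual_basis N L \<Psi> u \<Xi>t \<Xi>r \<alpha>)
     + sq_norm2_stacked (L + 1) (residual_state N L \<Xi>t \<Xi>r \<alpha>)
     + \<mu> * sq_norm2 (N - L + 1) \<alpha>"

definition feasible ::
    "nat \<Rightarrow> nat \<Rightarrow> (nat \<Rightarrow> real ^ 'n) \<Rightarrow> (nat \<Rightarrow> real ^ 'n) \<Rightarrow> (nat \<Rightarrow> real) \<Rightarrow> bool" where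
  "feasible N L \<Xi>t \<Xi>r \<alpha> \<longleftrightarrow> \<Xi>r 0 = hankel_mult (N - L + 1) 1 (window \<Xi>t 0) \<alpha> 0"

end

theory Submission
  imports Defs
begin

text \<open>
  The error is controlled one step at a time. Write \<open>F = Phi f h d \<sigma>\<close>. Since output \<open>i\<close> has relative
  degree \<open>d i\<close>, the extended state \<open>\<Xi>\<^sub>k\<close> is the image of the state under the coordinate change, and
  every trajectory satisfies \<open>y\<^sub>i\<^sub>,\<^sub>k\<^sub>+\<^sub>d = F\<^sub>i (u\<^sub>k, \<Xi>\<^sub>k)\<close> with \<open>d = d i\<close> (\<open>output_at_relative_degree\<close>). In the
  new coordinates the system is thus a bank of delay chains driven by \<open>F\<close>.

  Although \<open>F\<close> is nonlinear, \<open>F = G \<Psi> + \<epsilon>\<close> is linear in \<open>\<Psi>\<close> up to \<open>\<epsilon>\<close>. A linear combination of data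
  values of \<open>F\<close> with weights \<open>\<alpha>\<close> is therefore close to \<open>F (uhat\<^sub>k, \<Xi>bar\<^sub>k)\<close> as soon as the same
  combination of the \<open>\<Psi>\<close>-values is close to \<open>\<Psi> (uhat\<^sub>k, \<Xi>bar\<^sub>k)\<close>
  (\<open>infnorm_combination_minus_value_le\<close>), and this second distance is a block of the residual of the
  optimization problem. The last row of each delay chain in block \<open>k + 1\<close> of the state residual says
  that the combination of the measured outputs is also close to \<open>ybar\<^sub>i\<^sub>,\<^sub>k\<^sub>+\<^sub>d\<close>.
  Noise enters twice: it separates measured outputs from values of \<open>F\<close>, and it perturbs the extended
  states at which \<open>\<Psi>\<close> is known; these two effects cost \<open>wmax\<close> and \<open>Kw * wmax\<close> per unit weight. Both residuals are at
  most \<open>sqrt b\<close> entrywise, because \<open>b\<close> is the sum of all their squares. Hence \<open>ybar\<^sub>i\<^sub>,\<^sub>k\<^sub>+\<^sub>d\<close> differs from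
  \<open>F\<^sub>i (uhat\<^sub>k, \<Xi>bar\<^sub>k)\<close> by at most the constant in parentheses in the theorem.

  The achieved output is \<open>yhat\<^sub>i\<^sub>,\<^sub>k\<^sub>+\<^sub>d = F\<^sub>i (uhat\<^sub>k, \<Xi>hat\<^sub>k)\<close>, so passing from \<open>\<Xi>bar\<^sub>k\<close> to \<open>\<Xi>hat\<^sub>k\<close> costs \<open>K\<Xi>\<close>
  times the largest error among the outputs collected in the extended state. The extended states
  agree at time \<open>0\<close>, and the resulting recursion sums to a geometric series
  (\<open>delay_chain_error_le_geometric\<close>).
\<close>

section \<open>Outputs in the extended coordinates\<close>

lemma state_add:
  "state f x u (k + l) = state f (state f x u k) (window u k) l"
  by (induction l) (simp_all add: window_def)

lemma state_zero_input:
  "state f x (\<lambda>_. 0) l = (drift f ^^ l) x"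
  by (induction l) (simp_all add: drift_def)

text \<open>Inputs cannot reach output \<open>i\<close> before the relative degree, so they may be replaced by \<open>0\<close>.\<close>

lemma output_below_relative_degree:
  assumes "relative_degree f h i di" and "j < di"
  shows "sys_output f h x u (k + j) $ i = h ((drift f ^^ j) (state f x u k)) $ i"
proof -
  let ?x = "state f x u k"
  have "sys_output f h x u (k + j) $ i = sys_output f h ?x (window u k) j $ i"
    by (simp add: sys_output_def state_add)
  also have "\<dots> = sys_output f h ?x (\<lambda>_. 0) j $ i"
    using assms unfolding relative_degree_def by blast
  finally show ?thesis
    by (simp add: sys_output_def state_zero_input)
qed

lemma stacking_obtain:
  assumes "stacking d \<sigma>" and "j < d i"
  obtains p where "\<sigma> p = (i, j)"
proof -
  have "(i, j) \<in> \<sigma> ` UNIV"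
    using assms unfolding stacking_def bij_betw_def by auto
  then show ?thesis using that by (metis imageE)
qed

lemma stacking_range:
  assumes "stacking d \<sigma>"
  shows "snd (\<sigma> p) < d (fst (\<sigma> p))"
proof -
  have "\<sigma> p \<in> (SIGMA i:UNIV. {..<d i})"
    using assms unfolding stacking_def by (rule bij_betw_apply) simp
  then show ?thesis by (cases "\<sigma> p") simp
qed

lemma ext_state_eq_coord_map:
  assumes "\<And>i. relative_degree f h i (d i)" and "stacking d \<sigma>"
  shows "ext_state \<sigma> (sys_output f h x u) k = coord_map f h \<sigma> (state f x u k)"
  by (simp add: ext_state_def coord_map_def vec_eq_iff
      output_below_relative_degree[OF assms(1) stacking_range[OF assms(2)]])

text \<open>After the input \<open>u k\<close> has acted, output \<open>i\<close> is still \<open>d i - 1\<close> steps away, which is below the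
  relative degree; so no later input matters.\<close>

lemma output_at_relative_degree:
  assumes rd: "\<And>i. relative_degree f h i (d i)" and st: "stacking d \<sigma>"
    and T: "inj (coord_map f h \<sigma>)"
  shows "sys_output f h x u (k + d i) $ i
           = Phi f h d \<sigma> (u k, ext_state \<sigma> (sys_output f h x u) k) $ i"
proof -
  have d: "1 \<le> d i" using rd[of i] by (simp add: relative_degree_def)
  have "sys_output f h x u (Suc k + (d i - 1)) $ i
          = h ((drift f ^^ (d i - 1)) (state f x u (Suc k))) $ i"
    by (rule output_below_relative_degree[OF rd]) (use d in simp)
  then show ?thesis
    using d by (simp add: Phi_def delayed_output_def ext_state_eq_coord_map[OF rd st] inv_f_f[OF T])
qed


section \<open>Max-norm estimates\<close>

lemma abs_component_diff_le_infnorm: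
  fixes x y :: "real ^ 'n"
  shows "\<bar>x $ i - y $ i\<bar> \<le> infnorm (x - y)"
  using component_le_infnorm_cart[of "x - y" i] by simp

lemma infnorm_le_cart:
  fixes x :: "real ^ 'n"
  assumes "\<And>i. \<bar>x $ i\<bar> \<le> B"
  shows "infnorm x \<le> B"
  unfolding infnorm_def
  by (rule cSup_least) (use assms in \<open>auto simp: Basis_vec_def inner_axis\<close>)

lemma infnorm_sum_scaleR_le:
  fixes v :: "'i \<Rightarrow> real ^ 'n"
  assumes "\<And>j. j \<in> J \<Longrightarrow> infnorm (v j) \<le> B"
  shows "infnorm (\<Sum>j\<in>J. a j *\<^sub>R v j) \<le> B * (\<Sum>j\<in>J. \<bar>a j\<bar>)"
proof (rule infnorm_le_cart)
  fix i
  have "\<bar>(\<Sum>j\<in>J. a j *\<^sub>R v j) $ i\<bar> \<le> (\<Sum>j\<in>J. \<bar>a j * v j $ i\<bar>)"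
    by (simp add: sum_component)
  also have "\<dots> \<le> (\<Sum>j\<in>J. B * \<bar>a j\<bar>)"
  proof (rule sum_mono)
    fix j assume "j \<in> J"
    then have "\<bar>v j $ i\<bar> \<le> B"
      using assms component_le_infnorm_cart order_trans by blast
    then show "\<bar>a j * v j $ i\<bar> \<le> B * \<bar>a j\<bar>"
      by (simp add: abs_mult mult.commute[of B] mult_left_mono)
  qed
  finally show "\<bar>(\<Sum>j\<in>J. a j *\<^sub>R v j) $ i\<bar> \<le> B * (\<Sum>j\<in>J. \<bar>a j\<bar>)"
    by (simp add: sum_distrib_left)
qed

text \<open>The supremum defining the induced norm is finite because the max-norm is equivalent to the
  Euclidean norm.\<close>

lemma mat_infnorm_bdd_above:
  fixes A :: "real ^ 'c ^ 'm"
  shows "bdd_above (range (\<lambda>x. infnorm (A *v x) / infnorm x))"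
proof (rule bdd_aboveI2)
  fix x :: "real ^ 'c"
  let ?s = "sqrt DIM(real ^ 'c)"
  have lin: "bounded_linear ((*v) A)" by simp
  have "infnorm (A *v x) \<le> onorm ((*v) A) * norm x"
    using infnorm_le_norm onorm[OF lin] order_trans by blast
  also have "\<dots> \<le> onorm ((*v) A) * (?s * infnorm x)"
    by (rule mult_left_mono[OF norm_le_infnorm onorm_pos_le[OF lin]])
  finally have *: "infnorm (A *v x) \<le> onorm ((*v) A) * ?s * infnorm x"
    by (simp add: mult.assoc)
  show "infnorm (A *v x) / infnorm x \<le> onorm ((*v) A) * ?s"
  proof (cases "infnorm x = 0")
    case True
    then show ?thesis using onorm_pos_le[OF lin] by simp
  next
    case False
    then have "0 < infnorm x" using infnorm_pos_le[of x] by linarith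
    then show ?thesis using * by (simp add: divide_le_eq)
  qed
qed

lemma infnorm_quotient_le_mat_infnorm: "infnorm (A *v x) / infnorm x \<le> mat_infnorm A"
  unfolding mat_infnorm_def by (rule cSUP_upper[OF UNIV_I mat_infnorm_bdd_above])

lemma infnorm_mult_le_mat_infnorm:
  "infnorm (A *v x) \<le> mat_infnorm A * infnorm x"
proof (cases "x = 0")
  case True
  then show ?thesis by (simp add: infnorm_0)
next
  case False
  then show ?thesis
    using infnorm_quotient_le_mat_infnorm[of A x] by (simp add: infnorm_pos_lt divide_le_eq)
qed

lemma mat_infnorm_nonneg: "0 \<le> mat_infnorm A"
  by (rule order_trans[OF divide_nonneg_nonneg infnorm_quotient_le_mat_infnorm[of A 0]])
    (rule infnorm_pos_le)+

lemma abs_component_le_sqrt_sq_norm2_stacked: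
  assumes "k < q"
  shows "\<bar>z k $ c\<bar> \<le> sqrt (sq_norm2_stacked q z)"
proof (rule real_le_rsqrt)
  have "(z k $ c)\<^sup>2 \<le> (\<Sum>c\<in>UNIV. (z k $ c)\<^sup>2)"
    by (rule member_le_sum) auto
  also have "\<dots> \<le> sq_norm2_stacked q z"
    unfolding sq_norm2_stacked_def
    using assms by (intro member_le_sum[where f = "\<lambda>k. \<Sum>c\<in>UNIV. (z k $ c)\<^sup>2"] sum_nonneg) auto
  finally show "\<bar>z k $ c\<bar>\<^sup>2 \<le> sq_norm2_stacked q z" by simp
qed

lemma sq_norm2_stacked_nonneg: "0 \<le> sq_norm2_stacked q z"
  by (simp add: sq_norm2_stacked_def sum_nonneg)


section \<open>One step: approximate superposition\<close>

lemma hankel_mult_eq_sum: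
  "hankel_mult M L z \<alpha> k = (\<Sum>j<M - L + 1. \<alpha> j *\<^sub>R z (k + j))"
  by (simp add: hankel_mult_def hankel_def window_def vec_eq_iff sum_component ac_simps)

text \<open>Superposition for \<open>F = G \<Psi> + \<epsilon>\<close>: the linear part carries a combination of \<open>\<Psi>\<close>-values over to
  \<open>F\<close>, and each of the remaining terms is paid for by an error bound. The data are known only through
  perturbed arguments \<open>zt\<close>, whence \<open>\<kappa>\<close>.\<close>

lemma infnorm_combination_minus_value_le:
  fixes F \<epsilon> :: "'z \<Rightarrow> real ^ 'm" and \<Psi> :: "'z \<Rightarrow> real ^ 'r" and G :: "real ^ 'r ^ 'm"
  assumes F: "\<And>z. F z = G *v \<Psi> z + \<epsilon> z"
    and \<epsilon>: "\<And>j. j \<in> J \<Longrightarrow> infnorm (\<epsilon> (zt j)) \<le> e" and \<epsilon>': "infnorm (\<epsilon> z') \<le> e"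
    and \<kappa>: "\<And>j. j \<in> J \<Longrightarrow> infnorm (F (z j) - F (zt j)) \<le> \<kappa>"
    and R: "infnorm ((\<Sum>j\<in>J. a j *\<^sub>R \<Psi> (zt j)) - \<Psi> z') \<le> R"
  shows "infnorm ((\<Sum>j\<in>J. a j *\<^sub>R F (z j)) - F z')
           \<le> e * (1 + (\<Sum>j\<in>J. \<bar>a j\<bar>)) + mat_infnorm G * R + \<kappa> * (\<Sum>j\<in>J. \<bar>a j\<bar>)"
proof -
  let ?\<delta> = "\<Sum>j\<in>J. a j *\<^sub>R (F (z j) - F (zt j))"
  let ?r = "(\<Sum>j\<in>J. a j *\<^sub>R \<Psi> (zt j)) - \<Psi> z'"
  let ?\<epsilon> = "\<Sum>j\<in>J. a j *\<^sub>R \<epsilon> (zt j)"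
  have "(\<Sum>j\<in>J. a j *\<^sub>R F (zt j)) = G *v (\<Sum>j\<in>J. a j *\<^sub>R \<Psi> (zt j)) + ?\<epsilon>"
    by (simp add: F scaleR_add_right sum.distrib matrix_vector_mult_scaleR linear_sum[OF matrix_vector_mul_linear])
  then have "(\<Sum>j\<in>J. a j *\<^sub>R F (z j)) - F z' = ?\<delta> + (G *v ?r + (?\<epsilon> - \<epsilon> z'))"
    by (simp add: F[of z'] scaleR_diff_right sum_subtractf matrix_vector_mult_diff_distrib)
  then have "infnorm ((\<Sum>j\<in>J. a j *\<^sub>R F (z j)) - F z')
      \<le> infnorm ?\<delta> + (infnorm (G *v ?r) + (infnorm ?\<epsilon> + infnorm (\<epsilon> z')))"
    using infnorm_triangle[of ?\<delta> "G *v ?r + (?\<epsilon> - \<epsilon> z')"] infnorm_triangle[of "G *v ?r" "?\<epsilon> - \<epsilon> z'"]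
      infnorm_triangle[of ?\<epsilon> "- \<epsilon> z'"] infnorm_neg[of "\<epsilon> z'"]
    by simp
  moreover have "infnorm ?\<delta> \<le> \<kappa> * (\<Sum>j\<in>J. \<bar>a j\<bar>)"
    by (rule infnorm_sum_scaleR_le[OF \<kappa>])
  moreover have "infnorm ?\<epsilon> \<le> e * (\<Sum>j\<in>J. \<bar>a j\<bar>)"
    by (rule infnorm_sum_scaleR_le[OF \<epsilon>])
  moreover have "infnorm (G *v ?r) \<le> mat_infnorm G * R"
    using infnorm_mult_le_mat_infnorm mult_left_mono[OF R mat_infnorm_nonneg] order_trans by blast
  ultimately show ?thesis using \<epsilon>' by (simp add: distrib_left)
qed


section \<open>Error recursion along delay chains\<close>

text \<open>The extended state at time \<open>k\<close> collects errors \<open>e (k + j) i\<close> with \<open>j < d i\<close>, each of which either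
  vanishes initially or equals \<open>e (l + d i) i\<close> for an earlier \<open>l < k\<close>. The bounds are nondecreasing in \<open>k\<close>, so
  the one for \<open>k - 1\<close> covers them all.\<close>

lemma delay_chain_error_le_geometric:
  fixes e :: "nat \<Rightarrow> 'i \<Rightarrow> real" and K C :: real
  assumes K: "0 \<le> K" and C: "0 \<le> C"
    and init: "\<And>i k. k < d i \<Longrightarrow> e k i = 0"
    and step: "\<And>k B i. k < L \<Longrightarrow> (\<And>i j. j < d i \<Longrightarrow> \<bar>e (k + j) i\<bar> \<le> B) \<Longrightarrow>
                 \<bar>e (k + d i) i\<bar> \<le> K * B + C"
  shows "k < L \<Longrightarrow> \<bar>e (k + d i) i\<bar> \<le> (\<Sum>l\<le>k. K ^ l) * C"
proof (induction k arbitrary: i rule: less_induct)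
  case (less k)
  define S where "S q = (\<Sum>l<q. K ^ l)" for q
  have S_mono: "S p * C \<le> S q * C" if "p \<le> q" for p q
    unfolding S_def using that K C by (intro mult_right_mono sum_mono2) auto
  have "\<bar>e (k + j) i'\<bar> \<le> S k * C" if "j < d i'" for i' j
  proof (cases "k + j < d i'")
    case True
    then show ?thesis using init S_mono[of 0 k] by (simp add: S_def)
  next
    case False
    define l where "l = k + j - d i'"
    have l: "k + j = l + d i'" "l < k" using False that by (auto simp: l_def)
    have "\<bar>e (l + d i') i'\<bar> \<le> S (Suc l) * C"
      using less.IH[of l i'] l(2) less.prems by (simp add: S_def lessThan_Suc_atMost)
    also have "\<dots> \<le> S k * C" using l(2) by (intro S_mono) simp
    finally show ?thesis by (simp add: l(1))
  qed
  then have "\<bar>e (k + d i) i\<bar> \<le> K * (S k * C) + C"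
    by (rule step[OF less.prems])
  also have "K * (S k * C) + C = S (Suc k) * C"
    by (simp add: S_def sum.lessThan_Suc_shift sum_distrib_left algebra_simps del: sum.lessThan_Suc)
  finally show ?case by (simp add: S_def lessThan_Suc_atMost)
qed


section \<open>The error bound\<close>

theorem theorem4:
  fixes f :: "(real ^ 'n) \<times> (real ^ 'm) \<Rightarrow> real ^ 'n"
    and h :: "real ^ 'n \<Rightarrow> real ^ 'm"
    and d :: "'m \<Rightarrow> nat"
    and \<sigma> :: "'n \<Rightarrow> 'm \<times> nat"
    and ut :: "real ^ 'n \<Rightarrow> real ^ 'm"
    and \<Omega> :: "((real ^ 'm) \<times> (real ^ 'n)) set"
    and \<Psi> :: "(real ^ 'm) \<times> (real ^ 'n) \<Rightarrow> real ^ 'r"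
    and G :: "real ^ 'r ^ 'm"
    and \<epsilon> :: "(real ^ 'm) \<times> (real ^ 'n) \<Rightarrow> real ^ 'm"
    and \<iota> :: "'m \<Rightarrow> 'r"
    and \<epsilon>max wmax K\<Xi> Kw lam b :: real
    and N L :: nat
    and x0 xbar0 :: "real ^ 'n"
    and u ubar uhat w y ytil ybar yhat :: "nat \<Rightarrow> real ^ 'm"
    and \<Xi> \<Xi>til \<Xi>bar \<Xi>hat :: "nat \<Rightarrow> real ^ 'n"
    and \<alpha> :: "nat \<Rightarrow> real"
  \<comment> \<open>system\<close>
  assumes f_analytic: "real_analytic f"
    and h_analytic: "real_analytic h"
    and f_zero: "f (0, 0) = 0"
    and h_zero: "h 0 = 0"
    and rel_deg: "\<And>i. relative_degree f h i (d i)"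
    and A1: "\<And>x i. h ((drift f ^^ (d i - 1)) (f (x, ut x))) $ i = 0"
    and A2: "\<And>x. rank (decoupling_matrix f h d x (ut x)) = CARD('m)"
    and A3: "(\<Sum>i\<in>UNIV. d i) = CARD('n)"
  \<comment> \<open>coordinate transformation\<close>
    and stack: "stacking d \<sigma>"
    and T_bij: "bij (coord_map f h \<sigma>)"
    and T_inv_C1: "continuously_differentiable (inv (coord_map f h \<sigma>))"
    and Phi_lipschitz: "locally_lipschitz (Phi f h d \<sigma>)"
  \<comment> \<open>basis functions\<close>
    and \<Omega>_compact: "compact \<Omega>"
    and \<Psi>_lipschitz: "\<And>l. locally_lipschitz (\<lambda>z. \<Psi> z $ l)"
    and \<Psi>_indep: "lin_indep_funs \<Psi>"
    and G_min: "is_arg_min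
          (\<lambda>A. L2_inner \<Omega> (\<lambda>z. Phi f h d \<sigma> z - A *v \<Psi> z) (\<lambda>z. Phi f h d \<sigma> z - A *v \<Psi> z))
          (\<lambda>_. True) G"
    and \<epsilon>_def: "\<And>z. Phi f h d \<sigma> z = G *v \<Psi> z + \<epsilon> z"
    and A4: "rank G = CARD('m)"
    and \<epsilon>max_pos: "\<epsilon>max > 0"
    and A5: "\<And>z. z \<in> \<Omega> \<Longrightarrow> infnorm (\<epsilon> z) \<le> \<epsilon>max"
    and \<iota>_inj: "inj \<iota>"
    and A6: "\<And>v X j. \<Psi> (v, X) $ \<iota> j = v $ j"
  \<comment> \<open>collected data\<close>
    and L_pos: "1 \<le> L"
    and L_le_N: "L \<le> N"
    and y_def: "\<And>k. y k = sys_output f h x0 u k"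
    and ytil_def: "\<And>k. ytil k = y k + w k"
    and w_bound: "\<And>k. infnorm (w k) \<le> wmax"
    and \<Xi>_def: "\<And>k. \<Xi> k = ext_state \<sigma> y k"
    and \<Xi>til_def: "\<And>k. \<Xi>til k = ext_state \<sigma> ytil k"
  \<comment> \<open>reference trajectory\<close>
    and ybar_def: "\<And>k. ybar k = sys_output f h xbar0 ubar k"
    and \<Xi>bar_def: "\<And>k. \<Xi>bar k = ext_state \<sigma> ybar k"
  \<comment> \<open>optimization problem, estimated input and achieved outputs\<close>
    and lam_pos: "lam > 0"
    and \<alpha>_opt: "is_arg_min (cost N L \<Psi> u \<Xi>til \<Xi>bar (lam * max \<epsilon>max wmax))
                  (feasible N L \<Xi>til \<Xi>bar) \<alpha>"
    and uhat_def: "\<And>k. k < L \<Longrightarrow> uhat k = hankel_mult N L u \<alpha> k"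
    and yhat_def: "\<And>k. yhat k = sys_output f h (inv (coord_map f h \<sigma>) (\<Xi>bar 0)) uhat k"
    and \<Xi>hat_def: "\<And>k. \<Xi>hat k = ext_state \<sigma> yhat k"
  \<comment> \<open>the data and the matched trajectories lie in the compact set\<close>
    and data_in: "\<And>k. k < N \<Longrightarrow> (u k, \<Xi> k) \<in> \<Omega> \<and> (u k, \<Xi>til k) \<in> \<Omega>"
    and matched_in: "\<And>k. k < L \<Longrightarrow> (uhat k, \<Xi>bar k) \<in> \<Omega> \<and> (uhat k, \<Xi>hat k) \<in> \<Omega>"
  \<comment> \<open>constants\<close>
    and K\<Xi>_nonneg: "0 \<le> K\<Xi>"
    and K\<Xi>_lipschitz: "\<And>v X X'. (v, X) \<in> \<Omega> \<Longrightarrow> (v, X') \<in> \<Omega> \<Longrightarrow>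
          infnorm (Phi f h d \<sigma> (v, X) - Phi f h d \<sigma> (v, X')) \<le> K\<Xi> * infnorm (X - X')"
    and Kw_pos: "Kw > 0"
    and Kw_bound: "\<And>k. k < N \<Longrightarrow>
          infnorm (G *v \<Psi> (u k, \<Xi> k) + \<epsilon> (u k, \<Xi> k)
                   - G *v \<Psi> (u k, \<Xi>til k) - \<epsilon> (u k, \<Xi>til k)) \<le> Kw * wmax"
    and b_def: "b = cost N L \<Psi> u \<Xi>til \<Xi>bar (lam * max \<epsilon>max wmax) \<alpha>
                    - lam * max \<epsilon>max wmax * sq_norm2 (N - L + 1) \<alpha>"
  shows "(\<forall>i. \<forall>k<d i. ybar k $ i - yhat k $ i = 0) \<and>
         (\<forall>k<L. \<forall>i. \<bar>ybar (k + d i) $ i - yhat (k + d i) $ i\<bar>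
            \<le> (\<Sum>l\<le>k. K\<Xi> ^ l) *
              (\<epsilon>max * (1 + norm1 (N - L + 1) \<alpha>)
               + (mat_infnorm G + 1) * sqrt b
               + wmax * (1 + Kw) * norm1 (N - L + 1) \<alpha>))"
proof -
  define F where "F = Phi f h d \<sigma>"
  define A where "A = norm1 (N - L + 1) \<alpha>"
  define R1 where "R1 = residual_basis N L \<Psi> u \<Xi>til \<Xi>bar \<alpha>"
  define R2 where "R2 = residual_state N L \<Xi>til \<Xi>bar \<alpha>"
  define C where "C = \<epsilon>max * (1 + A) + (mat_infnorm G + 1) * sqrt b + wmax * (1 + Kw) * A"
  let ?J = "{..<N - L + 1}"
  let ?xhat0 = "inv (coord_map f h \<sigma>) (\<Xi>bar 0)"

  have fn: "y = sys_output f h x0 u" "ybar = sys_output f h xbar0 ubar"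
      "yhat = sys_output f h ?xhat0 uhat"
    by (auto simp: y_def ybar_def yhat_def)
  note at_degree = output_at_relative_degree[OF rel_deg stack bij_is_inj[OF T_bij], folded F_def]
  have y_step: "y (k + d i) $ i = F (u k, \<Xi> k) $ i" for k i
    unfolding fn(1) \<Xi>_def by (rule at_degree)
  have yhat_step: "yhat (k + d i) $ i = F (uhat k, \<Xi>hat k) $ i" for k i
    unfolding fn(3) \<Xi>hat_def by (rule at_degree)

  have "\<Xi>hat 0 = \<Xi>bar 0"
    unfolding \<Xi>hat_def fn(3) ext_state_eq_coord_map[OF rel_deg stack]
    by (simp add: surj_f_inv_f[OF bij_is_surj[OF T_bij]])
  then have init: "ybar k $ i - yhat k $ i = 0" if k: "k < d i" for i k
  proof -
    obtain p where "\<sigma> p = (i, k)" using stacking_obtain[OF stack k] .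
    then show ?thesis
      using arg_cong[OF \<open>\<Xi>hat 0 = \<Xi>bar 0\<close>, of "\<lambda>X. X $ p"]
      by (simp add: \<Xi>hat_def \<Xi>bar_def ext_state_def)
  qed

  have A_nonneg: "0 \<le> A" by (simp add: A_def norm1_def sum_nonneg)
  have w_nonneg: "0 \<le> wmax" using w_bound[of 0] infnorm_pos_le order_trans by blast
  have b: "b = sq_norm2_stacked L R1 + sq_norm2_stacked (L + 1) R2"
    by (simp add: b_def cost_def R1_def R2_def)
  have b_nonneg: "0 \<le> b" by (simp add: b sq_norm2_stacked_nonneg)
  have C_nonneg: "0 \<le> C"
    unfolding C_def using A_nonneg w_nonneg b_nonneg \<epsilon>max_pos Kw_pos mat_infnorm_nonneg[of G]
    by (intro add_nonneg_nonneg mult_nonneg_nonneg) auto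
  have R1_le: "infnorm (R1 k) \<le> sqrt b" if "k < L" for k
  proof (rule infnorm_le_cart)
    fix c
    have "\<bar>R1 k $ c\<bar> \<le> sqrt (sq_norm2_stacked L R1)"
      by (rule abs_component_le_sqrt_sq_norm2_stacked[OF that])
    also have "\<dots> \<le> sqrt b" by (simp add: b sq_norm2_stacked_nonneg)
    finally show "\<bar>R1 k $ c\<bar> \<le> sqrt b" .
  qed
  have R2_le: "\<bar>R2 k $ p\<bar> \<le> sqrt b" if "k < L + 1" for k p
  proof -
    have "\<bar>R2 k $ p\<bar> \<le> sqrt (sq_norm2_stacked (L + 1) R2)"
      by (rule abs_component_le_sqrt_sq_norm2_stacked[OF that])
    also have "\<dots> \<le> sqrt b" by (simp add: b sq_norm2_stacked_nonneg)
    finally show ?thesis .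
  qed

  have ref_step: "\<bar>ybar (k + d i) $ i - F (uhat k, \<Xi>bar k) $ i\<bar> \<le> C" if k: "k < L" for k i
  proof -
    have kN: "k + j < N" if "j \<in> ?J" for j using that k L_le_N by auto
    have uhat_k: "hankel_mult (N - L + 1) 1 (window u k) \<alpha> 0 = uhat k"
      by (simp add: uhat_def[OF k] hankel_mult_eq_sum window_def)
    have "infnorm ((\<Sum>j\<in>?J. \<alpha> j *\<^sub>R F (u (k + j), \<Xi> (k + j))) - F (uhat k, \<Xi>bar k))
            \<le> \<epsilon>max * (1 + A) + mat_infnorm G * sqrt b + Kw * wmax * A"
      unfolding A_def norm1_def
    proof (rule infnorm_combination_minus_value_le[where F = F and \<Psi> = \<Psi> and \<epsilon> = \<epsilon>
          and z = "\<lambda>j. (u (k + j), \<Xi> (k + j))" and zt = "\<lambda>j. (u (k + j), \<Xi>til (k + j))"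
          and z' = "(uhat k, \<Xi>bar k)"])
      show "F z = G *v \<Psi> z + \<epsilon> z" for z by (simp add: F_def \<epsilon>_def)
      show "infnorm (\<epsilon> (u (k + j), \<Xi>til (k + j))) \<le> \<epsilon>max" if "j \<in> ?J" for j
        using A5 data_in[OF kN[OF that]] by blast
      show "infnorm (\<epsilon> (uhat k, \<Xi>bar k)) \<le> \<epsilon>max"
        using A5 matched_in[OF k] by blast
      show "infnorm (F (u (k + j), \<Xi> (k + j)) - F (u (k + j), \<Xi>til (k + j))) \<le> Kw * wmax"
        if "j \<in> ?J" for j
        using Kw_bound[OF kN[OF that]] by (simp add: F_def \<epsilon>_def diff_diff_eq)
      show "infnorm ((\<Sum>j\<in>?J. \<alpha> j *\<^sub>R \<Psi> (u (k + j), \<Xi>til (k + j))) - \<Psi> (uhat k, \<Xi>bar k)) \<le> sqrt b"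
        using R1_le[OF k] by (simp only: R1_def residual_basis_def uhat_k) (simp add: hankel_mult_eq_sum)
    qed
    then have comb: "\<bar>(\<Sum>j\<in>?J. \<alpha> j *\<^sub>R F (u (k + j), \<Xi> (k + j))) $ i - F (uhat k, \<Xi>bar k) $ i\<bar>
            \<le> \<epsilon>max * (1 + A) + mat_infnorm G * sqrt b + Kw * wmax * A"
      by (rule order_trans[OF abs_component_diff_le_infnorm])
    have noise: "\<bar>(\<Sum>j\<in>?J. \<alpha> j *\<^sub>R w (k + j + d i)) $ i\<bar> \<le> wmax * A"
      unfolding A_def norm1_def
      by (rule order_trans[OF component_le_infnorm_cart infnorm_sum_scaleR_le]) (rule w_bound)
    \<comment> \<open>The last entry of chain \<open>i\<close> in the extended state at time \<open>k + 1\<close> is the output at \<open>k + d i\<close>.\<close>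
    have d: "1 \<le> d i" using rel_deg[of i] by (simp add: relative_degree_def)
    then obtain p where p: "\<sigma> p = (i, d i - 1)"
      using stacking_obtain[OF stack, of "d i - 1" i] by auto
    have "R2 (k + 1) $ p = (\<Sum>j\<in>?J. \<alpha> j *\<^sub>R ytil (k + j + d i)) $ i - ybar (k + d i) $ i"
      using d by (simp add: R2_def residual_state_def hankel_mult_eq_sum \<Xi>til_def \<Xi>bar_def
          ext_state_def p sum_component ac_simps)
    also have "(\<Sum>j\<in>?J. \<alpha> j *\<^sub>R ytil (k + j + d i)) $ i
        = (\<Sum>j\<in>?J. \<alpha> j *\<^sub>R F (u (k + j), \<Xi> (k + j))) $ i + (\<Sum>j\<in>?J. \<alpha> j *\<^sub>R w (k + j + d i)) $ i"
      by (simp add: ytil_def y_step sum_component distrib_left sum.distrib)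
    finally have "ybar (k + d i) $ i - F (uhat k, \<Xi>bar k) $ i
        = ((\<Sum>j\<in>?J. \<alpha> j *\<^sub>R F (u (k + j), \<Xi> (k + j))) $ i - F (uhat k, \<Xi>bar k) $ i)
          + (\<Sum>j\<in>?J. \<alpha> j *\<^sub>R w (k + j + d i)) $ i - R2 (k + 1) $ p"
      by simp
    moreover have "\<bar>R2 (k + 1) $ p\<bar> \<le> sqrt b" using R2_le k by simp
    ultimately have "\<bar>ybar (k + d i) $ i - F (uhat k, \<Xi>bar k) $ i\<bar>
        \<le> (\<epsilon>max * (1 + A) + mat_infnorm G * sqrt b + Kw * wmax * A) + wmax * A + sqrt b"
      using comb noise by linarith
    also have "\<dots> = C" by (simp add: C_def algebra_simps)
    finally show ?thesis .
  qed

  have step: "\<bar>ybar (k + d i) $ i - yhat (k + d i) $ i\<bar> \<le> K\<Xi> * B + C"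
    if k: "k < L" and B: "\<And>i j. j < d i \<Longrightarrow> \<bar>ybar (k + j) $ i - yhat (k + j) $ i\<bar> \<le> B" for k B i
  proof -
    have "infnorm (\<Xi>bar k - \<Xi>hat k) \<le> B"
      by (rule infnorm_le_cart)
        (simp add: \<Xi>bar_def \<Xi>hat_def ext_state_def B[OF stacking_range[OF stack]])
    then have "K\<Xi> * infnorm (\<Xi>bar k - \<Xi>hat k) \<le> K\<Xi> * B"
      using K\<Xi>_nonneg by (rule mult_left_mono)
    moreover have "infnorm (F (uhat k, \<Xi>bar k) - F (uhat k, \<Xi>hat k)) \<le> K\<Xi> * infnorm (\<Xi>bar k - \<Xi>hat k)"
      unfolding F_def using matched_in[OF k] by (intro K\<Xi>_lipschitz) auto
    ultimately have "infnorm (F (uhat k, \<Xi>bar k) - F (uhat k, \<Xi>hat k)) \<le> K\<Xi> * B"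
      by (rule order_trans[rotated])
    then have "\<bar>F (uhat k, \<Xi>bar k) $ i - F (uhat k, \<Xi>hat k) $ i\<bar> \<le> K\<Xi> * B"
      by (rule order_trans[OF abs_component_diff_le_infnorm])
    then show ?thesis using ref_step[OF k, of i] by (simp add: yhat_step)
  qed

  have "\<bar>ybar (k + d i) $ i - yhat (k + d i) $ i\<bar> \<le> (\<Sum>l\<le>k. K\<Xi> ^ l) * C" if "k < L" for k i
    using delay_chain_error_le_geometric[where e = "\<lambda>k i. ybar k $ i - yhat k $ i" and d = d,
        OF K\<Xi>_nonneg C_nonneg init step that] .
  then show ?thesis using init unfolding C_def A_def by blast
qed

end
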